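(* There is no subsequence of $\{\Gamma_n\}_{n\in\mathbb{N}}$ with uniformly bounded second derivative on $[-\pi,\pi]$. Equivalently, $\|F_n''\|_{L^\infty([-\pi,\pi])}\to\infty$ as $n\to\infty$.
   Context: For $n\in\mathbb{N}$ and a prime $p$, $v_p(n!)$ denotes the exponent of $p$ in the prime factorization of $n!$. For each $n\in\mathbb{N}$ define $F_n(t)=\sum_{p\le n} v_p(n!)\,e^{ipt}$ for $t\in[-\pi,\pi]$, where the sum runs over primes $p\le n$. The associated planar curve is $\Gamma_n(t)=(\operatorname{Re}F_n(t),\operatorname{Im}F_n(t))\in\mathbb{R}^2$, $t\in[-\pi,\pi]$, so that $|\Gamma_n''(t)|=|F_n''(t)|$. A subsequence $(\Gamma_{n_k})_k$ (with $n_1<n_2<\cdots$) has uniformly bounded second derivative if there is a constant $M$ with $|\Gamma_{n_k}''(t)|\le M$ for all $k$ and all $t\in[-\pi,\pi]$. *)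

theory Defs
  imports
    "HOL-Analysis.Analysis"
    "HOL-Computational_Algebra.Primes"
    "HOL-Probability.Essential_Supremum"
begin

definition F :: "nat \<Rightarrow> real \<Rightarrow> complex" where
  "F n t = (\<Sum>p | prime p \<and> p \<le> n.
      of_nat (multiplicity p (fact n)) * exp (\<i> * of_nat p * of_real t))"

definition Gamma_curve :: "nat \<Rightarrow> real \<Rightarrow> real \<times> real" where
  "Gamma_curve n t = (Re (F n t), Im (F n t))"

text \<open>Both derivatives are taken within \<open>S\<close>, hence one-sided at the endpoints
  when \<open>S\<close> is a compact interval.\<close>

definition second_derivative_on ::
    "real set \<Rightarrow> (real \<Rightarrow> 'a::real_normed_vector) \<Rightarrow> real \<Rightarrow> 'a" where
  "second_derivative_on S f t =
     vector_derivative (\<lambda>s. vector_derivative f (at s within S)) (at t within S)"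

definition uniformly_bounded_second_derivative ::
    "real set \<Rightarrow> (nat \<Rightarrow> real \<Rightarrow> 'a::real_normed_vector) \<Rightarrow> bool" where
  "uniformly_bounded_second_derivative S f \<longleftrightarrow>
     (\<exists>M::real. \<forall>k. \<forall>t\<in>S. norm (second_derivative_on S (f k) t) \<le> M)"

text \<open>Extended-real valued; \<open>esssup\<close> takes the value \<open>\<infinity>\<close> on functions that are not measurable.\<close>

definition Linfty_norm :: "real set \<Rightarrow> (real \<Rightarrow> 'a::real_normed_vector) \<Rightarrow> ereal" where
  "Linfty_norm S f = esssup (lebesgue_on S) (\<lambda>t. ereal (norm (f t)))"

end

theory Submission
  imports Defs
begin

text \<open>At \<open>t = 0\<close> all exponentials in \<open>F'' n t = - (\<Sum>p\<le>n. v\<^sub>p(n!) p\<^sup>2 e\<^sup>i\<^sup>p\<^sup>t)\<close> equal 1,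
  so nothing cancels and already the summand \<open>p = 2\<close> gives \<open>\<bar>F'' n 0\<bar> \<ge> 4 v\<^sub>2(n!) \<ge> 4 \<lfloor>n/2\<rfloor>\<close>.
  By continuity the essential supremum dominates the value at \<open>0\<close>.\<close>

text \<open>The inner derivative is itself taken within the interval, so it agrees with
  \<open>f'\<close> only there, which suffices for the outer derivative within the same interval.
  \<open>a < b\<close> makes derivatives within it unique, endpoints included.\<close>

lemma second_derivative_on_eqI:
  fixes f :: "real \<Rightarrow> 'a::euclidean_space"
  assumes "a < b" and t: "t \<in> {a..b}"
    and f': "\<And>s. s \<in> {a..b} \<Longrightarrow> (f has_vector_derivative f' s) (at s within {a..b})"
    and f'': "(f' has_vector_derivative f'') (at t within {a..b})"
  shows "second_derivative_on {a..b} f t = f''"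
proof -
  have "vector_derivative f (at s within {a..b}) = f' s" if "s \<in> {a..b}" for s
    using vector_derivative_within_closed_interval[OF \<open>a < b\<close> that f'[OF that]] .
  then have "((\<lambda>s. vector_derivative f (at s within {a..b})) has_vector_derivative f'')
      (at t within {a..b})"
    using has_vector_derivative_transform[OF t _ f''] by auto
  then show ?thesis
    unfolding second_derivative_on_def
    by (rule vector_derivative_within_closed_interval[OF \<open>a < b\<close> t])
qed

text \<open>If the value at \<open>x\<close> exceeded the essential supremum, then by continuity so
  would all values on an open neighbourhood of \<open>x\<close>, which has positive measure. Taking
  \<open>x\<close> in the interior makes this neighbourhood open in the real line, not just relative
  to \<open>S\<close>.\<close>

lemma norm_le_Linfty_norm:
  fixes f :: "real \<Rightarrow> 'a::real_normed_vector"
  assumes cont: "continuous_on S f" and S: "S \<in> sets lebesgue" and x: "x \<in> interior S"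
  shows "ereal (norm (f x)) \<le> Linfty_norm S f"
proof (rule ccontr)
  assume "\<not> ?thesis"
  then have less: "Linfty_norm S f < ereal (norm (f x))" by simp
  define U where "U = {t \<in> interior S. Linfty_norm S f < ereal (norm (f t))}"
  have "continuous_on (interior S) (\<lambda>t. ereal (norm (f t)))"
    using continuous_on_subset[OF cont interior_subset] by (intro continuous_intros)
  then have "open ((\<lambda>t. ereal (norm (f t))) -` {Linfty_norm S f<..} \<inter> interior S)"
    by (simp add: continuous_on_open_vimage)
  also have "(\<lambda>t. ereal (norm (f t))) -` {Linfty_norm S f<..} \<inter> interior S = U"
    by (auto simp: U_def)
  finally have "open U" .
  moreover have "x \<in> U" using x less by (simp add: U_def)
  ultimately have "\<not> negligible U" using open_not_negligible by blast
  have "AE t in lebesgue_on S. ereal (norm (f t)) \<le> Linfty_norm S f"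
    unfolding Linfty_norm_def by (rule esssup_AE)
  then have "AE t in lebesgue. t \<in> S \<longrightarrow> ereal (norm (f t)) \<le> Linfty_norm S f"
    using S by (simp add: AE_restrict_space_iff)
  then have "AE t in lebesgue. t \<notin> U"
    by eventually_elim (use interior_subset in \<open>auto simp: U_def\<close>)
  then have "negligible U"
    using \<open>open U\<close> by (simp add: negligible_iff_null_sets AE_iff_null_sets borel_open)
  with \<open>\<not> negligible U\<close> show False ..
qed

text \<open>Keeping the order \<open>k\<close> as a parameter lets one differentiation rule serve
  for the first and the second derivative.\<close>

definition F_deriv :: "nat \<Rightarrow> nat \<Rightarrow> real \<Rightarrow> complex" where
  "F_deriv k n t = (\<Sum>p | prime p \<and> p \<le> n.
      of_nat (multiplicity p (fact n)) * (\<i> * of_nat p) ^ k * exp (\<i> * of_nat p * of_real t))"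

lemma F_deriv_0: "F_deriv 0 n = F n"
  by (simp add: F_deriv_def F_def fun_eq_iff)

lemma F_deriv_has_vector_derivative:
  "(F_deriv k n has_vector_derivative F_deriv (Suc k) n t) (at t within S)"
proof -
  have "((\<lambda>t. of_nat m * (\<i> * of_nat p) ^ k * exp (\<i> * of_nat p * of_real t))
      has_vector_derivative of_nat m * (\<i> * of_nat p) ^ Suc k * exp (\<i> * of_nat p * of_real t))
      (at t within S)" for m p :: nat
    \<comment> \<open>Each summand is an entire function restricted to the reals, so its complex
      derivative is used.\<close>
    by (rule has_vector_derivative_real_field) (auto intro!: derivative_eq_intros)
  then show ?thesis
    unfolding F_deriv_def [abs_def] by (intro has_vector_derivative_sum)
qed

lemma continuous_on_F_deriv: "continuous_on S (F_deriv k n)"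
  using F_deriv_has_vector_derivative
  by (meson continuous_on_eq_continuous_within has_vector_derivative_continuous)

lemma second_derivative_on_F:
  assumes "a < b" "t \<in> {a..b}"
  shows "second_derivative_on {a..b} (F n) t = F_deriv 2 n t"
  using F_deriv_has_vector_derivative[of 0 n] F_deriv_has_vector_derivative[of 1 n]
  by (intro second_derivative_on_eqI[OF assms, where f' = "F_deriv 1 n"])
     (simp_all add: F_deriv_0 numeral_2_eq_2)

lemma second_derivative_on_Gamma_curve:
  assumes "a < b" "t \<in> {a..b}"
  shows "second_derivative_on {a..b} (Gamma_curve n) t =
    (Re (F_deriv 2 n t), Im (F_deriv 2 n t))"
proof -
  have "((\<lambda>s. (Re (F_deriv k n s), Im (F_deriv k n s))) has_vector_derivative
      (Re (F_deriv (Suc k) n s), Im (F_deriv (Suc k) n s))) (at s within {a..b})" for k s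
    by (intro has_vector_derivative_Pair bounded_linear.has_vector_derivative[OF bounded_linear_Re]
        bounded_linear.has_vector_derivative[OF bounded_linear_Im] F_deriv_has_vector_derivative)
  from this[of 0] this[of 1] show ?thesis
    by (intro second_derivative_on_eqI[OF assms,
          where f' = "\<lambda>s. (Re (F_deriv 1 n s), Im (F_deriv 1 n s))"])
       (simp_all add: F_deriv_0 numeral_2_eq_2 Gamma_curve_def [abs_def])
qed

text \<open>Passing from \<open>m\<close> to \<open>m + 1\<close> brings in the new even factor
  \<open>2 * m + 2\<close>.\<close>

lemma power_2_dvd_fact_double: "(2::nat) ^ m dvd fact (2 * m)"
proof (induction m)
  case (Suc m)
  have "2 * 2 ^ m dvd (2 * m + 2) * ((2 * m + 1) * fact (2 * m) :: nat)"
    using Suc by (intro mult_dvd_mono) auto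
  then show ?case by (simp add: algebra_simps)
qed simp

lemma multiplicity_2_fact_ge: "n div 2 \<le> multiplicity 2 (fact n :: nat)"
proof (rule multiplicity_geI)
  have "(2::nat) ^ (n div 2) dvd fact (2 * (n div 2))"
    by (rule power_2_dvd_fact_double)
  also have "\<dots> dvd fact n" by (rule fact_dvd) simp
  finally show "(2::nat) ^ (n div 2) dvd fact n" .
qed auto

lemma norm_F_deriv_2_at_0_ge: "real (n div 2) \<le> norm (F_deriv 2 n 0)"
proof (cases "n \<ge> 2")
  case True
  let ?P = "{p. prime p \<and> p \<le> n}"
  let ?s = "\<Sum>p\<in>?P. multiplicity p (fact n :: nat) * p\<^sup>2"
  \<comment> \<open>The factor 4 is given away here, since any unbounded lower bound will
    do.\<close>
  have "n div 2 \<le> multiplicity 2 (fact n :: nat) * 2\<^sup>2"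
    using multiplicity_2_fact_ge[of n] by simp
  also have "\<dots> \<le> ?s"
    using True by (intro member_le_sum) auto
  finally have "n div 2 \<le> ?s" .
  \<comment> \<open>The square of \<open>\<i>\<close> gives every term the same sign, so the norm is
    the full sum.\<close>
  moreover have "F_deriv 2 n 0 = - of_nat ?s"
    by (simp add: F_deriv_def power_mult_distrib sum_negf)
  then have "norm (F_deriv 2 n 0) = real ?s"
    by (simp only: norm_minus_cancel norm_of_nat)
  ultimately show ?thesis by (simp only: of_nat_le_iff)
qed simp

theorem theorem6p1:
  shows "(\<nexists>r :: nat \<Rightarrow> nat. strict_mono r \<and>
            uniformly_bounded_second_derivative {-pi..pi} (\<lambda>k. Gamma_curve (r k)))
       \<and> (\<lambda>n. Linfty_norm {-pi..pi} (second_derivative_on {-pi..pi} (F n))) \<longlonglongrightarrow> \<infinity>"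
proof
  show "\<nexists>r :: nat \<Rightarrow> nat. strict_mono r \<and>
      uniformly_bounded_second_derivative {-pi..pi} (\<lambda>k. Gamma_curve (r k))"
  proof clarify
    fix r :: "nat \<Rightarrow> nat"
    assume r: "strict_mono r"
      and "uniformly_bounded_second_derivative {-pi..pi} (\<lambda>k. Gamma_curve (r k))"
    then obtain M where
      M: "norm (second_derivative_on {-pi..pi} (Gamma_curve (r k)) 0) \<le> M" for k
      unfolding uniformly_bounded_second_derivative_def by fastforce
    obtain m :: nat where m: "M < real m" using reals_Archimedean2 by blast
    have "norm (F_deriv 2 (r (2 * m)) 0) \<le> M"
      using M[of "2 * m"]
      \<comment> \<open>The product norm on the plane is Euclidean, hence equal to the complex
        modulus.\<close>
      by (simp add: second_derivative_on_Gamma_curve norm_Pair cmod_def)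
    \<comment> \<open>The index \<open>2 * m\<close> is chosen so that halving
      \<open>r (2 * m)\<close> still leaves at least \<open>m\<close>, which exceeds
      \<open>M\<close>.\<close>
    moreover have "2 * m \<le> r (2 * m)" using r by (rule seq_suble)
    then have "m \<le> r (2 * m) div 2" by linarith
    ultimately show False
      using m norm_F_deriv_2_at_0_ge[of "r (2 * m)"] by linarith
  qed
  have lower: "ereal (real (n div 2)) \<le>
      Linfty_norm {-pi..pi} (second_derivative_on {-pi..pi} (F n))" for n
  proof -
    \<comment> \<open>Continuity transfers from \<open>F_deriv 2 n\<close>, which coincides with the
      second derivative on the interval.\<close>
    have "continuous_on {-pi..pi} (second_derivative_on {-pi..pi} (F n))"
      using continuous_on_F_deriv[of "{-pi..pi}" 2 n]
      by (rule continuous_on_eq) (simp add: second_derivative_on_F)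
    then have "ereal (norm (second_derivative_on {-pi..pi} (F n) 0)) \<le>
        Linfty_norm {-pi..pi} (second_derivative_on {-pi..pi} (F n))"
      by (rule norm_le_Linfty_norm) auto
    moreover have "second_derivative_on {-pi..pi} (F n) 0 = F_deriv 2 n 0"
      by (rule second_derivative_on_F) auto
    ultimately show ?thesis
      using norm_F_deriv_2_at_0_ge[of n] by (metis ereal_less_eq(3) order_trans)
  qed
  show "(\<lambda>n. Linfty_norm {-pi..pi} (second_derivative_on {-pi..pi} (F n))) \<longlonglongrightarrow> \<infinity>"
    unfolding tendsto_PInfty
  proof
    fix c :: real
    obtain m :: nat where m: "c < real m" using reals_Archimedean2 by blast
    show "\<forall>\<^sub>F n in sequentially.
        ereal c < Linfty_norm {-pi..pi} (second_derivative_on {-pi..pi} (F n))"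
      using eventually_ge_at_top[of "2 * m"]
    proof eventually_elim
      case (elim n)
      then have "m \<le> n div 2" by linarith
      with m have "ereal c < ereal (real (n div 2))" by simp
      also note lower[of n]
      finally show ?case .
    qed
  qed
qed

end
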